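(* Let $k$ be a positive integer and let $G$ be a connected graph with adjacency matrix $A$, spectral radius $\rho$ and principal eigenvector $y$. Let $p(x)\in\mathbb{R}_k[x]$ be a polynomial such that $p(A)$ is positive semidefinite and $p(\rho)>0$. Then $$\alpha_k(G)\leq p(\rho)^{-1}\max_{u\in V(G)}\frac{(p(A))_{uu}}{y_u^2}.$$
   Context: Graphs are finite, simple, undirected, with nonempty vertex set $V(G)$. The spectral radius $\rho$ of $G$ is the spectral radius of its adjacency matrix. The principal eigenvector of a connected graph $G$ is the unique entrywise positive eigenvector $y$ of the adjacency matrix corresponding to the eigenvalue $\rho$ with $\sum_{u\in V(G)}y_u^2=1$. A $k$-independent set of $G$ is a set of vertices any two distinct members of which are at distance greater than $k$ in $G$; $\alpha_k(G)$ is the maximum size of a $k$-independent set. $\mathbb{R}_k[x]$ is the set of real polynomials of degree at most $k$. *)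

theory Defs
  imports
    "Jordan_Normal_Form.Spectral_Radius"
    "Graph_Theory.Graph_Theory"
begin

text \<open>
  A finite simple undirected graph is a symmetric, loop-free digraph without multiple arcs,
  i.e. an instance of the locale \<open>graph\<close>. Matrices are indexed by positions
  \<open>i < n\<close>, so the vertices are listed in a (distinct) list \<open>vs\<close>;
  index \<open>i\<close> stands for the vertex \<open>vs ! i\<close>.
\<close>

definition adjacency_mat :: "('a, 'b) pre_digraph \<Rightarrow> 'a list \<Rightarrow> real mat" where
  "adjacency_mat G vs = mat (length vs) (length vs)
     (\<lambda>(i, j). if vs ! i \<rightarrow>\<^bsub>G\<^esub> vs ! j then 1 else 0)"

text \<open>\<open>spectral_radius\<close> is only available for complex matrices.\<close>

definition real_spectral_radius :: "real mat \<Rightarrow> real" where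
  "real_spectral_radius A = spectral_radius (map_mat complex_of_real A)"

text \<open>For the adjacency matrix of a connected graph there is exactly one such vector.\<close>

definition principal_eigenvector :: "real mat \<Rightarrow> real vec \<Rightarrow> bool" where
  "principal_eigenvector A y \<longleftrightarrow>
     eigenvector A y (real_spectral_radius A) \<and>
     (\<forall>i < dim_vec y. y $ i > 0) \<and>
     (\<Sum>i < dim_vec y. (y $ i)\<^sup>2) = 1"

definition poly_mat :: "real poly \<Rightarrow> real mat \<Rightarrow> real mat" where
  "poly_mat p A = mat (dim_row A) (dim_row A)
     (\<lambda>(i, j). \<Sum>l \<le> degree p. coeff p l * (A ^\<^sub>m l) $$ (i, j))"

definition pos_semidef :: "real mat \<Rightarrow> bool" where
  "pos_semidef M \<longleftrightarrow> transpose_mat M = M \<and>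
     (\<forall>x \<in> carrier_vec (dim_row M). 0 \<le> x \<bullet> (M *\<^sub>v x))"

text \<open>Length of a shortest walk (every arc has weight 1).\<close>

definition graph_dist :: "('a, 'b) pre_digraph \<Rightarrow> 'a \<Rightarrow> 'a \<Rightarrow> ereal" where
  "graph_dist G u v = wf_digraph.\<mu> G (\<lambda>_. 1) u v"

definition k_independent :: "('a, 'b) pre_digraph \<Rightarrow> nat \<Rightarrow> 'a set \<Rightarrow> bool" where
  "k_independent G k S \<longleftrightarrow> S \<subseteq> verts G \<and>
     (\<forall>u \<in> S. \<forall>v \<in> S. u \<noteq> v \<longrightarrow> graph_dist G u v > ereal (real k))"

definition k_independence_number :: "('a, 'b) pre_digraph \<Rightarrow> nat \<Rightarrow> nat" where
  "k_independence_number G k = Max (card ` {S. k_independent G k S})"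

end

theory Submission
  imports Defs
begin

text \<open>
  Write \<open>M = p(A)\<close>, so that \<open>M y = p(\<rho>) y\<close>. Entries of \<open>M\<close> at vertices of distance greater
  than \<open>k\<close> vanish, because \<open>p\<close> has degree at most \<open>k\<close>; hence \<open>M\<close> is diagonal on a
  \<open>k\<close>-independent set \<open>S\<close>. Let \<open>c\<close> have entries \<open>1 / y\<^sub>u\<close> on \<open>S\<close> and \<open>0\<close> elsewhere.
  Since \<open>c \<bullet> y = |S|\<close>, the quadratic form of \<open>M\<close> at \<open>c - |S| y\<close> is
  \<open>(\<Sum>u\<in>S. M\<^sub>u\<^sub>u / y\<^sub>u\<^sup>2) - p(\<rho>) |S|\<^sup>2\<close>, and it is nonnegative.
\<close>

lemma quadratic_form_sum:
  fixes M :: "real mat"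
  assumes "M \<in> carrier_mat n n" and "x \<in> carrier_vec n"
  shows "x \<bullet> (M *\<^sub>v x) = (\<Sum>i<n. \<Sum>j<n. x $ i * M $$ (i, j) * x $ j)"
  using assms
  by (auto simp: scalar_prod_def sum_distrib_left mult.assoc atLeast0LessThan intro!: sum.cong)

text \<open>Each power \<open>A ^\<^sub>m l\<close> scales \<open>y\<close> by
  \<open>\<rho> ^ l\<close>, and swapping the sums over \<open>j\<close> and \<open>l\<close>
  collects these factors into \<open>poly p \<rho>\<close>. The equation is given entry by entry,
  the form in which the double sums of the quadratic form use it.\<close>

lemma eigenvector_poly_mat:
  fixes A :: "real mat"
  assumes A: "A \<in> carrier_mat n n" and ev: "eigenvector A y \<rho>" and i: "i < n"
  shows "(\<Sum>j<n. poly_mat p A $$ (i, j) * y $ j) = poly p \<rho> * y $ i"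
proof -
  have y: "y \<in> carrier_vec n" using ev A by (auto simp: eigenvector_def)
  have pow: "(\<Sum>j<n. (A ^\<^sub>m l) $$ (i, j) * y $ j) = \<rho> ^ l * y $ i" for l
  proof -
    have "dim_row (A ^\<^sub>m l) = n" "dim_col (A ^\<^sub>m l) = n"
      using A pow_carrier_mat[OF A, of l] by auto
    then have "(A ^\<^sub>m l *\<^sub>v y) $ i = (\<Sum>j<n. (A ^\<^sub>m l) $$ (i, j) * y $ j)"
      using y i by (simp add: scalar_prod_def atLeast0LessThan del: pow_mat_dim_square)
    then show ?thesis using eigenvector_pow[OF A ev, of l] y i by auto
  qed
  have "(\<Sum>j<n. poly_mat p A $$ (i, j) * y $ j)
      = (\<Sum>j<n. \<Sum>l\<le>degree p. coeff p l * ((A ^\<^sub>m l) $$ (i, j) * y $ j))"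
    using A i by (intro sum.cong) (auto simp: poly_mat_def sum_distrib_right mult.assoc)
  also have "\<dots> = (\<Sum>l\<le>degree p. coeff p l * (\<Sum>j<n. (A ^\<^sub>m l) $$ (i, j) * y $ j))"
    by (subst sum.swap) (simp add: sum_distrib_left)
  also have "\<dots> = poly p \<rho> * y $ i"
    by (simp add: pow poly_altdef sum_distrib_right mult.assoc)
  finally show ?thesis .
qed

text \<open>Splitting off the last factor, a nonzero entry needs some nonzero summand: an
  intermediate \<open>m\<close> reached by a walk of length \<open>l\<close>, followed by an arc
  from \<open>vs ! m\<close> to \<open>vs ! j\<close>. Existence of a walk suffices here, so walks
  are not counted.\<close>

lemma adjacency_mat_pow_nonzero_imp_walk:
  assumes "wf_digraph G" and "set vs = verts G"
    and "i < length vs" and "j < length vs"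
    and "(adjacency_mat G vs ^\<^sub>m l) $$ (i, j) \<noteq> 0"
  shows "\<exists>w. pre_digraph.awalk G (vs ! i) w (vs ! j) \<and> length w = l"
  using assms(4,5)
proof (induction l arbitrary: j)
  interpret wf_digraph G by fact
  case 0
  then have "i = j" using assms(3) by (auto simp: adjacency_mat_def split: if_splits)
  moreover have "vs ! i \<in> verts G" using assms(2,3) nth_mem by blast
  ultimately show ?case by (auto simp: awalk_Nil_iff intro!: exI[of _ "[]"])
next
  interpret wf_digraph G by fact
  case (Suc l)
  let ?n = "length vs" and ?A = "adjacency_mat G vs"
  have A: "?A \<in> carrier_mat ?n ?n" by (simp add: adjacency_mat_def)
  have "(?A ^\<^sub>m Suc l) $$ (i, j) = (\<Sum>m<?n. (?A ^\<^sub>m l) $$ (i, m) * ?A $$ (m, j))"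
    using A assms(3) Suc.prems(1) by (auto simp: scalar_prod_def atLeast0LessThan intro!: sum.cong)
  with Suc.prems(2) obtain m where m: "m < ?n" "(?A ^\<^sub>m l) $$ (i, m) \<noteq> 0" "?A $$ (m, j) \<noteq> 0"
    by (metis (no_types, lifting) lessThan_iff mult_eq_0_iff sum.neutral)
  obtain w where w: "awalk (vs ! i) w (vs ! m)" "length w = l" using Suc.IH m by blast
  from m Suc.prems(1) have "vs ! m \<rightarrow>\<^bsub>G\<^esub> vs ! j"
    by (auto simp: adjacency_mat_def split: if_splits)
  then obtain e where "e \<in> arcs G" "tail G e = vs ! m" "head G e = vs ! j"
    by (auto simp: arcs_ends_def arc_to_ends_def)
  then have "awalk (vs ! m) [e] (vs ! j)" using arc_implies_awalk by metis
  with w show ?case by (intro exI[of _ "w @ [e]"]) auto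
qed

text \<open>Every summand vanishes separately: a nonzero entry of a power
  \<open>l \<le> degree p\<close> would give a walk of length at most \<open>k\<close>.\<close>

lemma poly_adjacency_mat_eq_zero:
  assumes "wf_digraph G" and "set vs = verts G"
    and "i < length vs" and "j < length vs"
    and "degree p \<le> k" and "graph_dist G (vs ! i) (vs ! j) > ereal (real k)"
  shows "poly_mat p (adjacency_mat G vs) $$ (i, j) = 0"
proof -
  interpret wf_digraph G by fact
  have "(adjacency_mat G vs ^\<^sub>m l) $$ (i, j) = 0" if "l \<le> degree p" for l
  proof (rule ccontr)
    assume "(adjacency_mat G vs ^\<^sub>m l) $$ (i, j) \<noteq> 0"
    then obtain w where w: "awalk (vs ! i) w (vs ! j)" "length w = l"
      using adjacency_mat_pow_nonzero_imp_walk[OF assms(1-4)] by blast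
    \<comment> \<open>With unit weights the cost of a walk is its length, and the distance is at
      most the cost of any walk.\<close>
    have "graph_dist G (vs ! i) (vs ! j) \<le> ereal (real l)"
      using min_cost_le_walk_cost[OF w(1), of "\<lambda>_. 1"] w(2)
      by (simp add: graph_dist_def awalk_cost_def sum_list_triv)
    also have "\<dots> \<le> ereal (real k)" using that assms(5) by simp
    finally show False using assms(6) by simp
  qed
  then show ?thesis using assms(3,4) by (simp add: poly_mat_def adjacency_mat_def)
qed

text \<open>The matrix core of the bound: the graph will enter only through \<open>diag\<close>, the
  vanishing of off-diagonal entries on \<open>I\<close>.\<close>

lemma card_le_of_diagonal_on:
  fixes M :: "real mat"
  assumes M: "M \<in> carrier_mat n n" and psd: "pos_semidef M"
    and y: "\<And>i. i < n \<Longrightarrow> y $ i > 0" and norm: "(\<Sum>i<n. (y $ i)\<^sup>2) = 1"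
    and ev: "\<And>i. i < n \<Longrightarrow> (\<Sum>j<n. M $$ (i, j) * y $ j) = q * y $ i" and q: "q > 0"
    and I: "I \<subseteq> {..<n}" "I \<noteq> {}"
    and diag: "\<And>i j. i \<in> I \<Longrightarrow> j \<in> I \<Longrightarrow> i \<noteq> j \<Longrightarrow> M $$ (i, j) = 0"
  shows "real (card I) \<le> inverse q * Max ((\<lambda>i. M $$ (i, i) / (y $ i)\<^sup>2) ` {..<n})"
proof -
  define s where "s = real (card I)"
  define c where "c = (\<lambda>i. if i \<in> I then 1 / y $ i else 0)"
  define mx where "mx = Max ((\<lambda>i. M $$ (i, i) / (y $ i)\<^sup>2) ` {..<n})"
  have finI: "finite I" using I finite_subset by blast
  then have s: "s > 0" using I by (auto simp: s_def card_gt_0_iff)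
  have symM: "M $$ (i, j) = M $$ (j, i)" if "i < n" "j < n" for i j
    using psd M that index_transpose_mat(1)[of i M j] by (auto simp: pos_semidef_def)
  \<comment> \<open>By symmetry \<open>y\<close> is also a left eigenvector, which handles the cross
    term with \<open>y\<close> on the left of \<open>M\<close>.\<close>
  have ev': "(\<Sum>j<n. y $ j * M $$ (j, i)) = q * y $ i" if "i < n" for i
    using ev[OF that] symM[OF that] by (simp add: mult.commute)
  have cy: "(\<Sum>i<n. c i * y $ i) = s"
  proof -
    have "(\<Sum>i<n. c i * y $ i) = (\<Sum>i\<in>I. c i * y $ i)"
      using I by (intro sum.mono_neutral_right) (auto simp: c_def)
    also have "\<dots> = (\<Sum>i\<in>I. 1)"
    proof (rule sum.cong)
      fix i assume "i \<in> I"
      then show "c i * y $ i = 1" using y[of i] I by (auto simp: c_def)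
    qed simp
    finally show ?thesis by (simp add: s_def)
  qed
  have cMc: "(\<Sum>i<n. \<Sum>j<n. c i * M $$ (i, j) * c j) = (\<Sum>i\<in>I. M $$ (i, i) / (y $ i)\<^sup>2)"
  proof -
    have "(\<Sum>j<n. c i * M $$ (i, j) * c j) = (if i \<in> I then M $$ (i, i) / (y $ i)\<^sup>2 else 0)"
      if "i < n" for i
    proof (cases "i \<in> I")
      case True
      have "(\<Sum>j<n. c i * M $$ (i, j) * c j) = (\<Sum>j<n. if j = i then c i * M $$ (i, i) * c i else 0)"
        using diag True by (intro sum.cong) (auto simp: c_def)
      also have "\<dots> = M $$ (i, i) / (y $ i)\<^sup>2"
        using that True by (simp add: c_def power2_eq_square)
      finally show ?thesis using True by simp
    qed (simp add: c_def)
    then have "(\<Sum>i<n. \<Sum>j<n. c i * M $$ (i, j) * c j)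
        = (\<Sum>i<n. if i \<in> I then M $$ (i, i) / (y $ i)\<^sup>2 else 0)" by simp
    also have "\<dots> = (\<Sum>i\<in>I. M $$ (i, i) / (y $ i)\<^sup>2)"
      using I by (subst sum.inter_restrict[symmetric]) (auto simp: Int_absorb1)
    finally show ?thesis .
  qed
  have cMy: "(\<Sum>i<n. \<Sum>j<n. c i * M $$ (i, j) * y $ j) = q * s"
  proof -
    have "(\<Sum>i<n. \<Sum>j<n. c i * M $$ (i, j) * y $ j) = (\<Sum>i<n. c i * (q * y $ i))"
      using ev by (intro sum.cong) (auto simp: mult.assoc simp flip: sum_distrib_left)
    also have "\<dots> = q * s" by (simp add: cy[symmetric] sum_distrib_left ac_simps)
    finally show ?thesis .
  qed
  have yMc: "(\<Sum>i<n. \<Sum>j<n. y $ i * M $$ (i, j) * c j) = q * s"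
  proof -
    have "(\<Sum>i<n. \<Sum>j<n. y $ i * M $$ (i, j) * c j) = (\<Sum>j<n. (q * y $ j) * c j)"
      using ev' by (subst sum.swap) (auto simp flip: sum_distrib_right)
    also have "\<dots> = q * s" by (simp add: cy[symmetric] sum_distrib_left ac_simps)
    finally show ?thesis .
  qed
  have yMy: "(\<Sum>i<n. \<Sum>j<n. y $ i * M $$ (i, j) * y $ j) = q"
  proof -
    have "(\<Sum>i<n. \<Sum>j<n. y $ i * M $$ (i, j) * y $ j) = (\<Sum>i<n. y $ i * (q * y $ i))"
      using ev by (intro sum.cong) (auto simp: mult.assoc simp flip: sum_distrib_left)
    also have "\<dots> = q * (\<Sum>i<n. (y $ i)\<^sup>2)"
      by (simp add: sum_distrib_left power2_eq_square ac_simps)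
    finally show ?thesis by (simp add: norm)
  qed
  \<comment> \<open>Since \<open>y\<close> is a unit vector and \<open>c\<close> has inner product
    \<open>s\<close> with it, \<open>?z\<close> is the component of \<open>c\<close> orthogonal to
    \<open>y\<close>. Among all \<open>c - t y\<close>, the choice \<open>t = s\<close> minimizes
    the form, as \<open>q > 0\<close>.\<close>
  let ?z = "vec n (\<lambda>i. c i - s * y $ i)"
  have "0 \<le> ?z \<bullet> (M *\<^sub>v ?z)" using psd M by (auto simp: pos_semidef_def)
  also have "\<dots> = (\<Sum>i<n. \<Sum>j<n. (c i - s * y $ i) * M $$ (i, j) * (c j - s * y $ j))"
    by (subst quadratic_form_sum[OF M]) auto
  also have "\<dots> = (\<Sum>i<n. \<Sum>j<n. c i * M $$ (i, j) * c j - s * (c i * M $$ (i, j) * y $ j)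
      - s * (y $ i * M $$ (i, j) * c j) + s\<^sup>2 * (y $ i * M $$ (i, j) * y $ j))"
    by (intro sum.cong refl) (simp add: algebra_simps power2_eq_square)
  also have "\<dots> = (\<Sum>i\<in>I. M $$ (i, i) / (y $ i)\<^sup>2) - s * (q * s) - s * (q * s) + s\<^sup>2 * q"
    by (simp add: sum.distrib sum_subtractf cMc cMy yMc yMy flip: sum_distrib_left)
  finally have "q * s * s \<le> (\<Sum>i\<in>I. M $$ (i, i) / (y $ i)\<^sup>2)"
    by (simp add: power2_eq_square algebra_simps)
  also have "\<dots> \<le> s * mx"
    unfolding s_def mx_def using I by (intro sum_bounded_above Max_ge) auto
  \<comment> \<open>One factor \<open>s\<close> cancels, since \<open>I\<close> is nonempty.\<close>
  finally have "q * s \<le> mx" using s by (simp add: mult.commute)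
  then have "s \<le> inverse q * mx" using q by (simp add: field_simps)
  then show ?thesis by (simp add: s_def mx_def)
qed

theorem corollary10:
  fixes G :: "('a, 'b) pre_digraph" and vs :: "'a list" and k :: nat
    and A :: "real mat" and \<rho> :: real and y :: "real vec" and p :: "real poly"
  assumes "k \<ge> 1"
    and "graph G" and "Digraph_Component.connected G"
    and "distinct vs" and "set vs = verts G"
    and "A = adjacency_mat G vs"
    and "\<rho> = real_spectral_radius A"
    and "principal_eigenvector A y"
    and "degree p \<le> k"
    and "pos_semidef (poly_mat p A)"
    and "poly p \<rho> > 0"
  shows "real (k_independence_number G k) \<le>
    inverse (poly p \<rho>) * Max ((\<lambda>i. poly_mat p A $$ (i, i) / (y $ i)\<^sup>2) ` {..<length vs})"
proof -
  interpret graph G by fact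
  define n where "n = length vs"
  define B where "B = inverse (poly p \<rho>) * Max ((\<lambda>i. poly_mat p A $$ (i, i) / (y $ i)\<^sup>2) ` {..<n})"
  have A: "A \<in> carrier_mat n n" using assms(6) by (simp add: adjacency_mat_def n_def)
  have M: "poly_mat p A \<in> carrier_mat n n" using A by (auto simp: poly_mat_def)
  have ev: "eigenvector A y \<rho>" and pos: "\<forall>i<dim_vec y. y $ i > 0"
    and norm: "(\<Sum>i<dim_vec y. (y $ i)\<^sup>2) = 1"
    using assms(7,8) by (auto simp: principal_eigenvector_def)
  have dim: "dim_vec y = n" using ev A by (auto simp: eigenvector_def)
  \<comment> \<open>An empty vector cannot have norm 1.\<close>
  have n: "n > 0" using norm dim by (cases n) auto
  have bound: "real (card I) \<le> B"
    if "I \<subseteq> {..<n}" "I \<noteq> {}" "k_independent G k ((!) vs ` I)" for I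
    unfolding B_def
  proof (rule card_le_of_diagonal_on[OF M assms(10)])
    fix i j assume ij: "i \<in> I" "j \<in> I" "i \<noteq> j"
    then have "i < length vs" "j < length vs" using that(1) by (auto simp: n_def)
    moreover from this have "vs ! i \<noteq> vs ! j" using ij assms(4) nth_eq_iff_index_eq by blast
    ultimately show "poly_mat p A $$ (i, j) = 0" unfolding assms(6)
      using ij that(3) assms(5,9)
      by (intro poly_adjacency_mat_eq_zero[OF wf_digraph_axioms]) (auto simp: k_independent_def)
  qed (use that pos norm dim ev A assms(11) eigenvector_poly_mat in auto)
  \<comment> \<open>\<open>bound\<close> excludes the empty set, for which the claim reads
    \<open>0 \<le> B\<close>. A single vertex is vacuously independent and settles this.\<close>
  have B0: "0 \<le> B"
  proof -
    have "vs ! 0 \<in> verts G" using n assms(5) nth_mem[of 0 vs] by (auto simp: n_def)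
    then have "real (card {0::nat}) \<le> B"
      using n by (intro bound) (auto simp: k_independent_def)
    then show ?thesis by simp
  qed
  have le: "real (card S) \<le> B" if "k_independent G k S" for S
  proof (cases "S = {}")
    case False
    \<comment> \<open>Passing from vertices to positions preserves cardinality because
      \<open>vs\<close> is distinct.\<close>
    define I where "I = {i. i < n \<and> vs ! i \<in> S}"
    have S: "S = (!) vs ` I"
      using that assms(5) by (auto simp: k_independent_def I_def n_def in_set_conv_nth image_iff)
        (metis in_set_conv_nth subsetD)
    have "card I = card S"
      unfolding S using assms(4)
      by (intro card_image[symmetric]) (auto simp: I_def n_def inj_on_def nth_eq_iff_index_eq)
    moreover have "real (card I) \<le> B"
    proof (rule bound)
      show "I \<subseteq> {..<n}" by (auto simp: I_def)
      show "I \<noteq> {}" using S False by blast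
      show "k_independent G k ((!) vs ` I)" using that S by argo
    qed
    ultimately show ?thesis by simp
  qed (use B0 in simp)
  \<comment> \<open>Finiteness and nonemptiness of the family ensure that \<open>Max\<close> is
    attained by some independent set, to which \<open>le\<close> applies.\<close>
  have "finite {S. k_independent G k S}"
    by (rule finite_subset[of _ "Pow (verts G)"]) (auto simp: k_independent_def)
  moreover have "k_independent G k {}" by (simp add: k_independent_def)
  ultimately have "k_independence_number G k \<in> card ` {S. k_independent G k S}"
    unfolding k_independence_number_def by (intro Max_in) auto
  then show ?thesis using le by (auto simp: B_def n_def)
qed

end
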